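(* Let $A,B$ be finite subsets of an abelian group $G$ (written additively) of the same size satisfying $A\cap(A+B)=\emptyset$, where $A+B=\{a+b : a\in A,\ b\in B\}$. Suppose that there are no $x,y,z,w\in B$ with $x+y=z+w$ and $\{x,y\}\cap\{z,w\}=\emptyset$. Then there exists an acyclic matching $f:A\to B$.
   Context: Let $G$ be an additive abelian group and let $A,B$ be finite subsets of $G$ of the same cardinality with $0\notin B$ (which is automatic when $A\cap(A+B)=\emptyset$). A matching from $A$ to $B$ is a bijection $f:A\to B$ such that $a+f(a)\notin A$ for every $a\in A$. The multiplicity function of a matching $f$ is $m_f:G\to\mathbb{Z}_{\ge 0}$, $m_f(x)=\#\{a\in A : a+f(a)=x\}$. A matching $f:A\to B$ is called acyclic if for every matching $g:A\to B$, $m_f=m_g$ implies $f=g$. *)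

theory Defs
  imports Main "HOL-Library.Set_Algebras"
begin

definition matching :: "'a::ab_group_add set \<Rightarrow> 'a set \<Rightarrow> ('a \<Rightarrow> 'a) \<Rightarrow> bool" where
  "matching A B f \<longleftrightarrow> bij_betw f A B \<and> (\<forall>a\<in>A. a + f a \<notin> A)"

definition matching_mult :: "'a::ab_group_add set \<Rightarrow> ('a \<Rightarrow> 'a) \<Rightarrow> 'a \<Rightarrow> nat" where
  "matching_mult A f x = card {a \<in> A. a + f a = x}"

text \<open>Matchings are maps with domain \<open>A\<close>, represented by total functions whose values
  outside \<open>A\<close> are irrelevant; hence two matchings are equal when they agree on \<open>A\<close>.\<close>

definition acyclic_matching :: "'a::ab_group_add set \<Rightarrow> 'a set \<Rightarrow> ('a \<Rightarrow> 'a) \<Rightarrow> bool" where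
  "acyclic_matching A B f \<longleftrightarrow> matching A B f \<and>
     (\<forall>g. matching A B g \<longrightarrow> matching_mult A f = matching_mult A g \<longrightarrow> (\<forall>a\<in>A. f a = g a))"

end

theory Submission
  imports Defs
begin

text \<open>Since \<open>A\<close> is disjoint from \<open>A + B\<close>, every bijection from \<open>A\<close> to \<open>B\<close> is a matching,
  so the task is to find a bijection that its multiplicity function determines among all
  bijections. Such a bijection is built greedily. Fix a sum \<open>x\<close> that occurs in \<open>A + B\<close>, and send
  every \<open>a \<in> A\<close> with \<open>x - a \<in> B\<close> to \<open>x - a\<close>: the number of summands equal to \<open>x\<close> is then as
  large as any bijection can make it, and a bijection that attains this number has no freedom on
  these elements. They and their images are matched with each other completely, so they can be
  deleted from \<open>A\<close> and \<open>B\<close>, and the same step applies to what is left. The multiplicity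
  function of the rest is that of the whole minus its value at \<open>x\<close>, because no deleted element
  contributes to another sum; hence the forced choices propagate through the whole construction.\<close>

text \<open>At most the elements \<open>a\<close> of \<open>A\<close> with \<open>x - a \<in> B\<close> can yield the sum \<open>x\<close>, so a map that
  yields it that many times uses all of them.\<close>

lemma sum_forced_by_maximal_mult:
  fixes A B :: "'a::ab_group_add set"
  assumes "finite A" and "g ` A \<subseteq> B"
    and "matching_mult A g x = card {a \<in> A. x - a \<in> B}"
    and "a \<in> A" and "x - a \<in> B"
  shows "g a = x - a"
proof -
  have "{a \<in> A. a + g a = x} \<subseteq> {a \<in> A. x - a \<in> B}"
    using assms(2) by auto
  with assms(1,3) have "{a \<in> A. a + g a = x} = {a \<in> A. x - a \<in> B}"
    by (intro card_subset_eq) (auto simp: matching_mult_def)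
  with assms(4,5) have "a + g a = x"
    by blast
  then show ?thesis
    by (simp add: algebra_simps)
qed

lemma matching_mult_cong:
  assumes "\<And>a. a \<in> A \<Longrightarrow> f a = g a"
  shows "matching_mult A f = matching_mult A g"
  using assms unfolding matching_mult_def by (intro ext arg_cong[where f = card]) auto

lemma matching_mult_split:
  assumes "finite A" and "C \<subseteq> A"
  shows "matching_mult A f y = matching_mult C f y + matching_mult (A - C) f y"
proof -
  have "{a \<in> A. a + f a = y} = {a \<in> C. a + f a = y} \<union> {a \<in> A - C. a + f a = y}"
    using assms(2) by auto
  then show ?thesis
    unfolding matching_mult_def
    using assms by (simp add: card_Un_disjoint finite_subset disjoint_iff)
qed

text \<open>The greedy construction, by induction on \<open>A\<close>. The uniqueness clause ranges over all
  bijections because that class is stable under the deletion: a competitor with the same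
  multiplicity function restricts to a bijection between the remaining sets.\<close>

lemma exists_bij_determined_by_mult:
  fixes A B :: "'a::ab_group_add set"
  assumes "finite A" and "finite B" and "card A = card B"
  shows "\<exists>f. bij_betw f A B \<and>
    (\<forall>g. bij_betw g A B \<longrightarrow> matching_mult A f = matching_mult A g \<longrightarrow> (\<forall>a\<in>A. f a = g a))"
  using assms
proof (induction A arbitrary: B rule: finite_psubset_induct)
  case (psubset A)
  show ?case
  proof (cases "A = {}")
    case True
    with psubset.prems show ?thesis by auto
  next
    case False
    with psubset.prems psubset.hyps have "B \<noteq> {}" by auto
    with False obtain a0 b0 where a0: "a0 \<in> A" and b0: "b0 \<in> B" by blast
    define x where "x = a0 + b0"
    define C where "C = {a \<in> A. x - a \<in> B}"
    define D where "D = (\<lambda>a. x - a) ` C"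
    have CA: "C \<subseteq> A" and DB: "D \<subseteq> B" by (auto simp: C_def D_def)
    have "a0 \<in> C" using a0 b0 by (simp add: C_def x_def)
    with CA have smaller: "A - C \<subset> A" by blast
    have bij_C: "bij_betw (\<lambda>a. x - a) C D"
      by (auto simp: D_def bij_betw_def inj_on_def)
    have "card (A - C) = card (B - D)"
      using CA DB psubset.hyps psubset.prems bij_betw_same_card[OF bij_C]
      by (simp add: card_Diff_subset finite_subset)
    with psubset.IH[OF smaller, of "B - D"] psubset.prems obtain h
      where bij_h: "bij_betw h (A - C) (B - D)"
        and h_unique: "\<And>g. bij_betw g (A - C) (B - D) \<Longrightarrow>
              matching_mult (A - C) h = matching_mult (A - C) g \<Longrightarrow> \<forall>a\<in>A - C. h a = g a"
      by auto
    define f where "f = (\<lambda>a. if a \<in> C then x - a else h a)"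
    have f_C: "f a = x - a" if "a \<in> C" for a using that by (simp add: f_def)
    have f_h: "f a = h a" if "a \<in> A - C" for a using that by (simp add: f_def)
    have "bij_betw f C D"
      using bij_C f_C by (simp cong: bij_betw_cong)
    moreover have "bij_betw f (A - C) (B - D)"
      using bij_h bij_betw_cong[of "A - C" f h] f_h by blast
    ultimately have "bij_betw f (C \<union> (A - C)) (D \<union> (B - D))"
      by (rule bij_betw_combine) blast
    with CA DB have bij_f: "bij_betw f A B" by (simp add: Un_absorb1)
    have "{a \<in> A. a + f a = x} = C"
    proof
      show "{a \<in> A. a + f a = x} \<subseteq> C"
        using bij_betw_imp_surj_on[OF bij_f] by (auto simp: C_def)
      show "C \<subseteq> {a \<in> A. a + f a = x}"
        using CA f_C by auto
    qed
    then have mult_f: "matching_mult A f x = card C"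
      by (simp add: matching_mult_def)
    have "\<forall>a\<in>A. f a = g a"
      if bij_g: "bij_betw g A B" and mult: "matching_mult A f = matching_mult A g" for g
    proof -
      have g_C: "g a = x - a" if "a \<in> C" for a
        using sum_forced_by_maximal_mult[OF psubset.hyps, of g B x a]
          bij_betw_imp_surj_on[OF bij_g] mult mult_f that
        by (simp add: C_def)
      have "g ` C = D" by (simp add: D_def g_C cong: image_cong)
      with bij_g CA have bij_g': "bij_betw g (A - C) (B - D)"
        using inj_on_image_set_diff[of g A A C]
        by (auto simp only: bij_betw_def Diff_subset intro: inj_on_subset)
      have "matching_mult C f = matching_mult C g"
        by (rule matching_mult_cong) (simp add: f_C g_C)
      with mult have "matching_mult (A - C) f = matching_mult (A - C) g"
        using matching_mult_split[OF psubset.hyps CA]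
        by (metis add_left_cancel ext)
      then have "matching_mult (A - C) h = matching_mult (A - C) g"
        using matching_mult_cong[of "A - C" f h] f_h by simp
      from h_unique[OF bij_g' this] show ?thesis
        using f_C f_h g_C by (metis DiffI)
    qed
    with bij_f show ?thesis by blast
  qed
qed

theorem proposition2p6:
  fixes A B :: "'a::ab_group_add set"
  assumes "finite A" and "finite B" and "card A = card B"
    and "A \<inter> (A + B) = {}"
    and "\<not> (\<exists>x\<in>B. \<exists>y\<in>B. \<exists>z\<in>B. \<exists>w\<in>B. x + y = z + w \<and> {x, y} \<inter> {z, w} = {})"
  shows "\<exists>f. acyclic_matching A B f"
proof -
  have matching_iff: "matching A B g \<longleftrightarrow> bij_betw g A B" for g
  proof -
    have "a + g a \<notin> A" if "bij_betw g A B" "a \<in> A" for a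
      using that assms(4) set_plus_intro[of a A "g a" B] by (auto dest: bij_betwE)
    then show ?thesis by (auto simp: matching_def)
  qed
  show ?thesis
    using exists_bij_determined_by_mult[OF assms(1-3)]
    unfolding acyclic_matching_def matching_iff .
qed

end
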